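(* For any tensor $T\in\mathbb{F}^{n_1}\otimes\mathbb{F}^{n_2}\otimes\mathbb{F}^{n_3}$ and any distinct $i,j\in[3]$, we have $\rho_{i,j}(T)\leq\underline{Q}(T)$.
   Context: For a nonzero matrix $A\in\mathbb{F}^{m_1\times m_2}$, its pivot $p(A)$ is the lexicographically smallest $(a,b)$ with $A_{a,b}\neq0$. Every subspace $\mathcal{A}$ of $m_1\times m_2$ matrices has a basis with pairwise distinct pivots, and the set of these pivots, $p(\mathcal{A})$, does not depend on the basis. $\rho(\mathcal{A})$ is the smallest $|S_1|+|S_2|$ with $S_1\subseteq[m_1]$, $S_2\subseteq[m_2]$ and $p(\mathcal{A})\subseteq(S_1\times[m_2])\cup([m_1]\times S_2)$. For $T=\sum T_{a_1,a_2,a_3}e_{a_1}\otimes e_{a_2}\otimes e_{a_3}$ and distinct $i,j$ with $\ell$ the remaining index, $\mathcal{A}_{i,j}\subseteq\mathbb{F}^{n_i}\otimes\mathbb{F}^{n_j}$ is the span over $t\in[n_\ell]$ of the matrices with rows indexed by $a_i$, columns by $a_j$ and entries $T$'s coefficients with $a_\ell=t$; $\rho_{i,j}(T)=\rho(\mathcal{A}_{i,j})$. The border subrank $\underline{Q}(T)$ is the largest $r$ such that there are matrices $A(\varepsilon),B(\varepsilon),C(\varepsilon)$ with Laurent polynomial entries in a formal variable $\varepsilon$ such that $(A(\varepsilon)\otimes B(\varepsilon)\otimes C(\varepsilon))T=\langle r\rangle+\varepsilon S_1+\cdots+\varepsilon^tS_t$ for some tensors $S_1,\dots,S_t$ over $\mathbb{F}$,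 where $\langle r\rangle=\sum_{i=1}^re_i\otimes e_i\otimes e_i$. *)

theory Defs
  imports Complex_Main "HOL-Library.Function_Algebras" "HOL-Library.Poly_Mapping"
begin

text \<open>
  Matrices and tensors are coefficient functions that vanish outside
  the index range, with indices counted from 1.
\<close>

definition matrices :: "nat \<Rightarrow> nat \<Rightarrow> (nat \<times> nat \<Rightarrow> 'a::zero) set" where
  "matrices m1 m2 = {A. \<forall>p. A p \<noteq> 0 \<longrightarrow> p \<in> {1..m1} \<times> {1..m2}}"

definition tensors :: "(nat \<Rightarrow> nat) \<Rightarrow> (nat \<Rightarrow> nat \<Rightarrow> nat \<Rightarrow> 'a::zero) set" where
  "tensors n = {T. \<forall>a1 a2 a3. T a1 a2 a3 \<noteq> 0 \<longrightarrow>
     a1 \<in> {1..n 1} \<and> a2 \<in> {1..n 2} \<and> a3 \<in> {1..n 3}}"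

definition mat_scale :: "'a::field \<Rightarrow> (nat \<times> nat \<Rightarrow> 'a) \<Rightarrow> (nat \<times> nat \<Rightarrow> 'a)" where
  "mat_scale c A = (\<lambda>p. c * A p)"

interpretation mat: vector_space mat_scale
  by unfold_locales (auto simp: mat_scale_def algebra_simps)

definition pivot :: "(nat \<times> nat \<Rightarrow> 'a::zero) \<Rightarrow> nat \<times> nat" where
  "pivot A = (THE p. A p \<noteq> 0 \<and>
     (\<forall>q. A q \<noteq> 0 \<longrightarrow> p = q \<or> (p, q) \<in> less_than <*lex*> less_than))"

definition pivot_basis ::
    "(nat \<times> nat \<Rightarrow> 'a::field) set \<Rightarrow> (nat \<times> nat \<Rightarrow> 'a) set \<Rightarrow> bool" where
  "pivot_basis \<A> B \<longleftrightarrow> \<not> mat.dependent B \<and> mat.span B = \<A> \<and> inj_on pivot B"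

text \<open>
  \<open>pivots\<close> is meant for spaces \<open>\<A> \<subseteq> matrices m1 m2\<close>: there a basis with distinct pivots
  exists, and all of them have the same set of pivots.
\<close>

definition pivots :: "(nat \<times> nat \<Rightarrow> 'a::field) set \<Rightarrow> (nat \<times> nat) set" where
  "pivots \<A> = (THE P. \<exists>B. pivot_basis \<A> B \<and> P = pivot ` B)"

text \<open>The parameters \<open>m1\<close>, \<open>m2\<close> are the format of the matrices in the space \<open>\<A>\<close>.\<close>

definition rho_space :: "nat \<Rightarrow> nat \<Rightarrow> (nat \<times> nat \<Rightarrow> 'a::field) set \<Rightarrow> nat" where
  "rho_space m1 m2 \<A> = (LEAST k. \<exists>S1 \<subseteq> {1..m1}. \<exists>S2 \<subseteq> {1..m2}.
     pivots \<A> \<subseteq> (S1 \<times> {1..m2}) \<union> ({1..m1} \<times> S2) \<and> k = card S1 + card S2)"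

text \<open>
  In \<open>slice i j T t\<close> the row index is put in position \<open>i\<close>, the column index in position
  \<open>j\<close>, and \<open>t\<close> in the remaining position.
\<close>

definition slice :: "nat \<Rightarrow> nat \<Rightarrow> (nat \<Rightarrow> nat \<Rightarrow> nat \<Rightarrow> 'a) \<Rightarrow> nat \<Rightarrow> nat \<times> nat \<Rightarrow> 'a" where
  "slice i j T t = (\<lambda>(a, b). let x = (\<lambda>_. t)(i := a, j := b) in T (x 1) (x 2) (x 3))"

definition slice_space ::
    "(nat \<Rightarrow> nat) \<Rightarrow> nat \<Rightarrow> nat \<Rightarrow> (nat \<Rightarrow> nat \<Rightarrow> nat \<Rightarrow> 'a::field) \<Rightarrow> (nat \<times> nat \<Rightarrow> 'a) set" where
  "slice_space n i j T =
     (let l = the_elem ({1, 2, 3} - {i, j}) in mat.span (slice i j T ` {1..n l}))"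

definition rho :: "(nat \<Rightarrow> nat) \<Rightarrow> nat \<Rightarrow> nat \<Rightarrow> (nat \<Rightarrow> nat \<Rightarrow> nat \<Rightarrow> 'a::field) \<Rightarrow> nat" where
  "rho n i j T = rho_space (n i) (n j) (slice_space n i j T)"

text \<open>
  Laurent polynomials in \<open>\<epsilon>\<close> are finitely supported functions on the exponents, with
  convolution as product; \<open>Poly_Mapping.single k c\<close> is \<open>c \<epsilon>\<^sup>k\<close>.
\<close>

type_synonym 'a laurent_poly = "int \<Rightarrow>\<^sub>0 'a"

definition apply_matrices ::
    "(nat \<Rightarrow> nat) \<Rightarrow> (nat \<times> nat \<Rightarrow> 'a laurent_poly) \<Rightarrow> (nat \<times> nat \<Rightarrow> 'a laurent_poly) \<Rightarrow>
     (nat \<times> nat \<Rightarrow> 'a laurent_poly) \<Rightarrow> (nat \<Rightarrow> nat \<Rightarrow> nat \<Rightarrow> 'a::field) \<Rightarrow>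
     (nat \<Rightarrow> nat \<Rightarrow> nat \<Rightarrow> 'a laurent_poly)" where
  "apply_matrices n A B C T = (\<lambda>b1 b2 b3. \<Sum>a1 = 1..n 1. \<Sum>a2 = 1..n 2. \<Sum>a3 = 1..n 3.
     A (b1, a1) * B (b2, a2) * C (b3, a3) * Poly_Mapping.single 0 (T a1 a2 a3))"

definition unit_tensor :: "nat \<Rightarrow> nat \<Rightarrow> nat \<Rightarrow> nat \<Rightarrow> 'a::zero_neq_one" where
  "unit_tensor r = (\<lambda>b1 b2 b3. if b1 \<in> {1..r} \<and> b1 = b2 \<and> b2 = b3 then 1 else 0)"

definition degenerates_to_unit ::
    "(nat \<Rightarrow> nat) \<Rightarrow> (nat \<Rightarrow> nat \<Rightarrow> nat \<Rightarrow> 'a::field) \<Rightarrow> nat \<Rightarrow> bool" where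
  "degenerates_to_unit n T r \<longleftrightarrow>
     (\<exists>A \<in> matrices r (n 1). \<exists>B \<in> matrices r (n 2). \<exists>C \<in> matrices r (n 3).
      \<exists>t. \<exists>S :: nat \<Rightarrow> nat \<Rightarrow> nat \<Rightarrow> nat \<Rightarrow> 'a. (\<forall>s \<in> {1..t}. S s \<in> tensors (\<lambda>_. r)) \<and>
        apply_matrices n A B C T = (\<lambda>b1 b2 b3. Poly_Mapping.single 0 (unit_tensor r b1 b2 b3) +
          (\<Sum>s = 1..t. Poly_Mapping.single (int s) (S s b1 b2 b3))))"

text \<open>
  Such \<open>r\<close> are bounded (by \<open>n 1\<close>, the rank of a flattening), so the greatest one exists;
  \<open>r = 0\<close> always qualifies.
\<close>

definition border_subrank :: "(nat \<Rightarrow> nat) \<Rightarrow> (nat \<Rightarrow> nat \<Rightarrow> nat \<Rightarrow> 'a::field) \<Rightarrow> nat" where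
  "border_subrank n T = (GREATEST r. degenerates_to_unit n T r)"

end

theory Submission
  imports Defs "HOL-Library.Product_Lexorder"
begin

text \<open>
  By Koenig's theorem \<open>\<rho>\<close> is the size \<open>r\<close> of a largest matching \<open>(a\<^sub>1, b\<^sub>1), \<dots>, (a\<^sub>r, b\<^sub>r)\<close> inside
  the set of pivots of the slice space. Choose linear combinations \<open>M\<^sub>k\<close> of the slices with pivot
  \<open>(a\<^sub>k, b\<^sub>k)\<close> and leading entry 1, and a linear functional \<open>w(a, b) = N a + b\<close> that induces the
  lexicographic order. Restricting to the rows \<open>a\<^sub>k\<close> and columns \<open>b\<^sub>k\<close>, scaled by \<open>\<epsilon>\<close> to the powers
  \<open>N a\<^sub>k\<close> and \<open>b\<^sub>k\<close>, and taking the slices \<open>\<epsilon>\<close> to the power \<open>- w(a\<^sub>k, b\<^sub>k)\<close> times \<open>M\<^sub>k\<close>, every nonzero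
  entry gets the exponent \<open>w(a\<^sub>p, b\<^sub>q) - w(a\<^sub>k, b\<^sub>k) \<ge> 0\<close>, with equality only for \<open>p = q = k\<close>. The result
  is the unit tensor of size \<open>r\<close> plus terms of positive order.
\<close>

subsection \<open>Matchings and vertex covers\<close>

text \<open>Finiteness is built in because \<open>card\<close> sends infinite sets to 0, which would
  make them free covers.\<close>

definition vertex_cover :: "('a \<times> 'b) set \<Rightarrow> 'a set \<Rightarrow> 'b set \<Rightarrow> bool" where
  "vertex_cover E S1 S2 \<longleftrightarrow> finite S1 \<and> finite S2 \<and> (\<forall>(x, y) \<in> E. x \<in> S1 \<or> y \<in> S2)"

lemma vertex_cover_converse: "vertex_cover (E\<inverse>) S2 S1 \<longleftrightarrow> vertex_cover E S1 S2"
  by (auto simp: vertex_cover_def)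

text \<open>
  Uncrossing: the two lattice combinations of the given covers have the same total size, and after
  adding \<open>x\<close> to one of them both cover \<open>E\<close>.
\<close>

lemma vertex_cover_exchange:
  fixes E :: "('a \<times> 'b) set"
  assumes edges: "(x, y) \<in> E" "(x, z) \<in> E" "y \<noteq> z"
    and S: "vertex_cover (E - {(x, y)}) S1 S2" "card S1 + card S2 < k"
    and T: "vertex_cover (E - {(x, z)}) T1 T2" "card T1 + card T2 < k"
  shows "\<exists>R1 R2. vertex_cover E R1 R2 \<and> card R1 + card R2 < k"
proof (cases "vertex_cover E S1 S2 \<or> vertex_cover E T1 T2")
  case True
  then show ?thesis using S T by blast
next
  case False
  \<comment> \<open>If \<open>x\<close> were in one of these sets, that cover would also catch its
    deleted edge and so cover all of \<open>E\<close>.\<close>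
  then have "x \<notin> S1" "x \<notin> T1"
    using S T by (auto simp: vertex_cover_def)
  then have "z \<in> S2" "y \<in> T2"
    using edges S T by (auto simp: vertex_cover_def)
  have fin: "finite S1" "finite S2" "finite T1" "finite T2"
    using S T by (auto simp: vertex_cover_def)
  have "vertex_cover E (S1 \<inter> T1) (S2 \<union> T2)"
    using S T \<open>z \<in> S2\<close> \<open>y \<in> T2\<close> unfolding vertex_cover_def by blast
  moreover have "vertex_cover E (insert x (S1 \<union> T1)) (S2 \<inter> T2)"
    using S T unfolding vertex_cover_def by blast
  moreover have "card (S1 \<inter> T1) + card (S1 \<union> T1) = card S1 + card T1"
    "card (S2 \<inter> T2) + card (S2 \<union> T2) = card S2 + card T2"
    using card_Un_Int[OF fin(1,3)] card_Un_Int[OF fin(2,4)] by simp_all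
  moreover have "card (insert x (S1 \<union> T1)) = Suc (card (S1 \<union> T1))"
    using fin \<open>x \<notin> S1\<close> \<open>x \<notin> T1\<close> by simp
  \<comment> \<open>The two new sizes add up to at most \<open>2 * (k - 1) + 1\<close>, so they
    cannot both reach \<open>k\<close>.\<close>
  ultimately have "card (S1 \<inter> T1) + card (S2 \<union> T2) < k \<or>
      card (insert x (S1 \<union> T1)) + card (S2 \<inter> T2) < k"
    using S T by linarith
  then show ?thesis
    using \<open>vertex_cover E (S1 \<inter> T1) (S2 \<union> T2)\<close>
      \<open>vertex_cover E (insert x (S1 \<union> T1)) (S2 \<inter> T2)\<close> by blast
qed

text \<open>Induction on the number of edges. If deleting some edge does not lower the least cover
  size, the matching of the smaller graph still works. Otherwise uncrossing shows that no two edges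
  share a vertex.\<close>

theorem koenig:
  fixes E :: "('a \<times> 'b) set"
  assumes "finite E"
  shows "\<exists>M \<subseteq> E. inj_on fst M \<and> inj_on snd M \<and>
    (\<exists>S1 S2. vertex_cover E S1 S2 \<and> card S1 + card S2 \<le> card M)"
  using assms
proof (induction "card E" arbitrary: E rule: less_induct)
  case less
  show ?case
  proof (cases "\<exists>e \<in> E. \<forall>S1 S2. vertex_cover (E - {e}) S1 S2 \<longrightarrow>
      (\<exists>R1 R2. vertex_cover E R1 R2 \<and> card R1 + card R2 \<le> card S1 + card S2)")
    case True
    then obtain e where e: "e \<in> E" and crit: "\<And>S1 S2. vertex_cover (E - {e}) S1 S2 \<Longrightarrow>
      \<exists>R1 R2. vertex_cover E R1 R2 \<and> card R1 + card R2 \<le> card S1 + card S2"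
      by blast
    have "card (E - {e}) < card E" "finite (E - {e})"
      using e less.prems by (simp_all add: card_Diff1_less del: card_Diff_insert card_Diff_singleton)
    from less.hyps[OF this] obtain M S1 S2 where M: "M \<subseteq> E - {e}" "inj_on fst M" "inj_on snd M"
      "vertex_cover (E - {e}) S1 S2" "card S1 + card S2 \<le> card M"
      by blast
    with crit[OF M(4)] show ?thesis
      by (meson Diff_subset order_trans)
  next
    case False
    then have "\<forall>e \<in> E. \<exists>S1 S2. vertex_cover (E - {e}) S1 S2 \<and>
      (\<forall>R1 R2. vertex_cover E R1 R2 \<longrightarrow> card S1 + card S2 < card R1 + card R2)"
      by (simp add: not_le)
    then obtain c1 c2 where c: "\<And>e. e \<in> E \<Longrightarrow> vertex_cover (E - {e}) (c1 e) (c2 e)"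
      and crit: "\<And>e R1 R2. e \<in> E \<Longrightarrow> vertex_cover E R1 R2 \<Longrightarrow>
        card (c1 e) + card (c2 e) < card R1 + card R2"
      by metis
    \<comment> \<open>Every edge is critical; then no two edges share a vertex, so \<open>E\<close> itself is a matching.\<close>
    have fst_unique: "y = z" if yz: "(x, y) \<in> E" "(x, z) \<in> E" for x y z
    proof (rule ccontr)
      assume "y \<noteq> z"
      \<comment> \<open>By \<open>crit\<close> every cover of \<open>E\<close> is larger than both
        reduced covers, so it has size at least \<open>k\<close>; the exchange yields a smaller
        one.\<close>
      define k where "k = Suc (max (card (c1 (x, y)) + card (c2 (x, y)))
        (card (c1 (x, z)) + card (c2 (x, z))))"
      have "card (c1 (x, y)) + card (c2 (x, y)) < k" "card (c1 (x, z)) + card (c2 (x, z)) < k"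
        by (auto simp: k_def)
      from vertex_cover_exchange[OF yz \<open>y \<noteq> z\<close> c[OF yz(1)] this(1) c[OF yz(2)] this(2)]
      obtain R1 R2 where "vertex_cover E R1 R2" "card R1 + card R2 < k"
        by blast
      then show False
        using crit[OF yz(1), of R1 R2] crit[OF yz(2), of R1 R2] by (auto simp: k_def)
    qed
    have snd_unique: "y = z" if yz: "(y, x) \<in> E" "(z, x) \<in> E" for x y z
    proof (rule ccontr)
      assume "y \<noteq> z"
      define k where "k = Suc (max (card (c1 (y, x)) + card (c2 (y, x)))
        (card (c1 (z, x)) + card (c2 (z, x))))"
      have "card (c2 (y, x)) + card (c1 (y, x)) < k" "card (c2 (z, x)) + card (c1 (z, x)) < k"
        by (auto simp: k_def)
      \<comment> \<open>The exchange lemma treats edges with a common left vertex, so the relation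
        is reversed and the sides of each cover are swapped.\<close>
      moreover have "vertex_cover (E\<inverse> - {(x, y)}) (c2 (y, x)) (c1 (y, x))"
        "vertex_cover (E\<inverse> - {(x, z)}) (c2 (z, x)) (c1 (z, x))"
        using c[OF yz(1)] c[OF yz(2)] by (auto simp: vertex_cover_def)
      ultimately obtain R1 R2 where "vertex_cover (E\<inverse>) R1 R2" "card R1 + card R2 < k"
        using vertex_cover_exchange[of x y "E\<inverse>" z] yz \<open>y \<noteq> z\<close> by blast
      then show False
        using crit[OF yz(1), of R2 R1] crit[OF yz(2), of R2 R1]
        by (auto simp: k_def vertex_cover_converse)
    qed
    have "inj_on fst E" "inj_on snd E"
      using fst_unique snd_unique by (auto simp: inj_on_def)
    moreover have "vertex_cover E (fst ` E) {}"
      using less.prems by (force simp: vertex_cover_def)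
    moreover have "card (fst ` E) + card ({} :: 'b set) \<le> card E"
      using card_image_le[OF less.prems, of fst] by simp
    ultimately show ?thesis
      by blast
  qed
qed

subsection \<open>Pivots\<close>

text \<open>Translates the explicit lexicographic relation of \<open>pivot\<close> into the type
  class order on pairs, a well-order to which \<open>Least\<close> and \<open>Min\<close>
  apply.\<close>

lemma pivot_eqI:
  assumes "A p \<noteq> 0" "\<And>q. A q \<noteq> 0 \<Longrightarrow> p \<le> q"
  shows "pivot A = p"
proof -
  have less: "(p, q) \<in> less_than <*lex*> less_than \<longleftrightarrow> p < q" for p q :: "nat \<times> nat"
    by (cases p; cases q) (auto simp: less_prod_def')
  show ?thesis
    unfolding pivot_def less
  proof (rule the_equality)
    show "A p \<noteq> 0 \<and> (\<forall>q. A q \<noteq> 0 \<longrightarrow> p = q \<or> p < q)"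
      using assms order_less_le by blast
    fix p' assume "A p' \<noteq> 0 \<and> (\<forall>q. A q \<noteq> 0 \<longrightarrow> p' = q \<or> p' < q)"
    then show "p' = p"
      using assms by (metis leD)
  qed
qed

lemma pivot_eq_Least:
  assumes "A \<noteq> 0"
  shows "pivot A = (LEAST p. A p \<noteq> 0)"
proof -
  obtain p where "A p \<noteq> 0"
    using assms by (auto simp: fun_eq_iff)
  then show ?thesis
    by (intro pivot_eqI LeastI[of "\<lambda>p. A p \<noteq> 0"] Least_le)
qed

lemma pivot_nonzero:
  assumes "A \<noteq> 0"
  shows "A (pivot A) \<noteq> 0"
proof -
  obtain p where "A p \<noteq> 0"
    using assms by (auto simp: fun_eq_iff)
  then show ?thesis
    unfolding pivot_eq_Least[OF assms] by (rule LeastI)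
qed

lemma pivot_le: "A p \<noteq> 0 \<Longrightarrow> pivot A \<le> p"
  by (subst pivot_eq_Least) (auto intro: Least_le)

lemma sum_fun_apply: "(\<Sum>x\<in>S. f x) p = (\<Sum>x\<in>S. f x p)"
  by (induction S rule: infinite_finite_induct) auto

text \<open>At the smallest pivot only one summand is nonzero, so nothing cancels there; before it
  all summands vanish.\<close>

lemma pivot_sum:
  fixes u :: "(nat \<times> nat \<Rightarrow> 'a::field) \<Rightarrow> 'a"
  assumes "finite V" "V \<noteq> {}" "inj_on pivot V" "\<And>v. v \<in> V \<Longrightarrow> v \<noteq> 0 \<and> u v \<noteq> 0"
  shows "(\<Sum>v\<in>V. mat_scale (u v) v) \<noteq> 0" "pivot (\<Sum>v\<in>V. mat_scale (u v) v) \<in> pivot ` V"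
proof -
  have "Min (pivot ` V) \<in> pivot ` V"
    using assms by (intro Min_in) auto
  then obtain w where w: "w \<in> V" "pivot w = Min (pivot ` V)"
    by auto
  have min: "pivot w \<le> pivot v" if "v \<in> V" for v
    using that assms(1) w(2) by simp
  let ?s = "\<Sum>v\<in>V. mat_scale (u v) v"
  have "u v * v (pivot w) = 0" if "v \<in> V - {w}" for v
  proof -
    have "pivot w < pivot v"
      using min[of v] that w(1) assms(3) by (auto simp: inj_on_def order_less_le)
    then show ?thesis
      using pivot_le[of v "pivot w"] by auto
  qed
  then have "(\<Sum>v\<in>V - {w}. u v * v (pivot w)) = 0"
    by (intro sum.neutral) blast
  then have "?s (pivot w) = u w * w (pivot w)"
    using sum.remove[OF assms(1) w(1), of "\<lambda>v. u v * v (pivot w)"]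
    by (simp add: sum_fun_apply mat_scale_def)
  then have nz: "?s (pivot w) \<noteq> 0"
    using assms(4)[OF w(1)] pivot_nonzero[of w] by simp
  then show "?s \<noteq> 0"
    by auto
  have "pivot w \<le> q" if q: "?s q \<noteq> 0" for q
  proof -
    have "(\<Sum>v\<in>V. u v * v q) \<noteq> 0"
      using q by (simp add: sum_fun_apply mat_scale_def)
    then obtain v where "v \<in> V" "v q \<noteq> 0"
      by (elim sum.not_neutral_contains_not_neutral) auto
    then show ?thesis
      using min[of v] pivot_le[of v q] by auto
  qed
  then have "pivot ?s = pivot w"
    using nz by (rule pivot_eqI[rotated])
  then show "pivot ?s \<in> pivot ` V"
    using w(1) by simp
qed

lemma independent_if_inj_on_pivot:
  fixes B :: "(nat \<times> nat \<Rightarrow> 'a::field) set"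
  assumes "inj_on pivot B" "0 \<notin> B"
  shows "\<not> mat.dependent B"
proof
  assume "mat.dependent B"
  then obtain V u where V: "finite V" "V \<subseteq> B" "(\<Sum>v\<in>V. mat_scale (u v) v) = 0" "\<exists>v\<in>V. u v \<noteq> 0"
    unfolding mat.dependent_explicit by auto
  let ?W = "{v \<in> V. u v \<noteq> 0}"
  have "(\<Sum>v\<in>?W. mat_scale (u v) v) = (\<Sum>v\<in>V. mat_scale (u v) v)"
    using V(1) by (intro sum.mono_neutral_left) auto
  moreover have "(\<Sum>v\<in>?W. mat_scale (u v) v) \<noteq> 0"
    using V assms by (intro pivot_sum) (auto intro: inj_on_subset)
  ultimately show False
    using V(3) by simp
qed

text \<open>The right-hand side does not mention \<open>B\<close>, so this gives the uniqueness
  behind the \<open>THE\<close> in \<open>pivots\<close>. Each element of the space is a combination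
  of basis vectors with nonzero coefficients, to which \<open>pivot_sum\<close> applies.\<close>

lemma pivot_basis_pivots:
  assumes "pivot_basis \<A> B"
  shows "pivot ` B = pivot ` (\<A> - {0})"
proof
  have B: "\<not> mat.dependent B" "mat.span B = \<A>" "inj_on pivot B"
    using assms by (auto simp: pivot_basis_def)
  have "0 \<notin> B"
    using B(1) mat.dependent_zero by blast
  then show "pivot ` B \<subseteq> pivot ` (\<A> - {0})"
    using B(2) mat.span_superset by blast
  show "pivot ` (\<A> - {0}) \<subseteq> pivot ` B"
  proof
    fix p assume "p \<in> pivot ` (\<A> - {0})"
    then obtain A where A: "A \<in> \<A>" "A \<noteq> 0" "p = pivot A"
      by auto
    then obtain V u where V: "finite V" "V \<subseteq> B" "A = (\<Sum>v\<in>V. mat_scale (u v) v)"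
      using B(2) by (auto simp: mat.span_explicit)
    let ?W = "{v \<in> V. u v \<noteq> 0}"
    have AW: "A = (\<Sum>v\<in>?W. mat_scale (u v) v)"
      unfolding V(3) using V(1) by (intro sum.mono_neutral_right) auto
    then have "?W \<noteq> {}"
      using A(2) by (metis sum.empty)
    then have "pivot A \<in> pivot ` ?W"
      unfolding AW using V B(3) \<open>0 \<notin> B\<close> by (intro pivot_sum) (auto intro: inj_on_subset)
    then show "p \<in> pivot ` B"
      using V(2) A(3) by blast
  qed
qed

text \<open>One matrix is chosen for each occurring pivot. These span by Gaussian elimination, which
  stops because the format has finitely many positions.\<close>

lemma pivot_basis_exists:
  fixes \<A> :: "(nat \<times> nat \<Rightarrow> 'a::field) set"
  assumes "mat.subspace \<A>" "\<A> \<subseteq> matrices m1 m2"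
  shows "\<exists>B. pivot_basis \<A> B"
proof -
  define P where "P = pivot ` (\<A> - {0})"
  have "\<forall>p \<in> P. \<exists>A \<in> \<A>. A \<noteq> 0 \<and> pivot A = p"
    by (auto simp: P_def)
  then obtain M where M: "\<And>p. p \<in> P \<Longrightarrow> M p \<in> \<A> \<and> M p \<noteq> 0 \<and> pivot (M p) = p"
    by metis
  have inj: "inj_on pivot (M ` P)"
    using M by (auto simp: inj_on_def)
  have "A \<in> mat.span (M ` P)" if "A \<in> \<A>" for A
    using that
  proof (induction "card {q \<in> {1..m1} \<times> {1..m2}. pivot A \<le> q}" arbitrary: A rule: less_induct)
    case less
    show ?case
    proof (cases "A = 0")
      case True
      then show ?thesis by (simp add: mat.span_zero)
    next
      case False
      define p where "p = pivot A"
      have p: "p \<in> P"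
        using False less.prems by (simp add: P_def p_def)
      note Mp = M[OF p]
      have nz: "A p \<noteq> 0" "M p p \<noteq> 0"
        using pivot_nonzero[OF False] pivot_nonzero[of "M p"] Mp by (simp_all add: p_def)
      \<comment> \<open>The leading entry is cancelled by the chosen matrix with the same pivot, so
        the pivot moves strictly later.\<close>
      define A' where "A' = A - mat_scale (A p / M p p) (M p)"
      have A': "A' \<in> \<A>"
        unfolding A'_def using less.prems Mp assms(1)
        by (intro mat.subspace_diff mat.subspace_scale) auto
      have "A' \<in> mat.span (M ` P)"
      proof (cases "A' = 0")
        case True
        then show ?thesis by (simp add: mat.span_zero)
      next
        case nonzero: False
        have "p \<le> q" if "A' q \<noteq> 0" for q
        proof -
          have "A q \<noteq> 0 \<or> M p q \<noteq> 0"
            using that by (auto simp: A'_def mat_scale_def)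
          then show ?thesis
            using pivot_le[of A q] pivot_le[of "M p" q] Mp by (auto simp: p_def)
        qed
        moreover have "A' p = 0"
          using nz by (simp add: A'_def mat_scale_def)
        ultimately have lt: "p < pivot A'"
          using pivot_nonzero[OF nonzero] by (metis order_less_le)
        have "p \<in> {1..m1} \<times> {1..m2}"
          using nz(1) less.prems assms(2) unfolding matrices_def by blast
        then have "p \<in> {q \<in> {1..m1} \<times> {1..m2}. p \<le> q}" "p \<notin> {q \<in> {1..m1} \<times> {1..m2}. pivot A' \<le> q}"
          using lt by (simp_all add: not_le)
        moreover have "{q \<in> {1..m1} \<times> {1..m2}. pivot A' \<le> q} \<subseteq> {q \<in> {1..m1} \<times> {1..m2}. p \<le> q}"
          using lt by (blast intro: order.trans less_imp_le)
        ultimately have "{q \<in> {1..m1} \<times> {1..m2}. pivot A' \<le> q} \<subset> {q \<in> {1..m1} \<times> {1..m2}. pivot A \<le> q}"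
          unfolding p_def[symmetric] by blast
        then have "card {q \<in> {1..m1} \<times> {1..m2}. pivot A' \<le> q} <
            card {q \<in> {1..m1} \<times> {1..m2}. pivot A \<le> q}"
          by (intro psubset_card_mono) auto
        then show ?thesis
          using A' less.hyps by blast
      qed
      moreover have "mat_scale (A p / M p p) (M p) \<in> mat.span (M ` P)"
        by (rule mat.span_scale[OF mat.span_base[OF imageI[OF p]]])
      ultimately have "A' + mat_scale (A p / M p p) (M p) \<in> mat.span (M ` P)"
        by (rule mat.span_add)
      then show ?thesis
        by (simp add: A'_def)
    qed
  qed
  moreover have "mat.span (M ` P) \<subseteq> \<A>"
    using M assms(1) by (intro mat.span_minimal) auto
  ultimately have "mat.span (M ` P) = \<A>"
    by blast
  moreover have "\<not> mat.dependent (M ` P)"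
    using M inj by (intro independent_if_inj_on_pivot) auto
  ultimately show ?thesis
    using inj unfolding pivot_basis_def by blast
qed

lemma pivots_eq:
  assumes "mat.subspace \<A>" "\<A> \<subseteq> matrices m1 m2"
  shows "pivots \<A> = pivot ` (\<A> - {0})"
proof -
  obtain B where "pivot_basis \<A> B"
    using pivot_basis_exists[OF assms] by blast
  then show ?thesis
    unfolding pivots_def using pivot_basis_pivots[of \<A>] by (intro the_equality) blast+
qed

lemma rho_space_le_matching:
  fixes \<A> :: "(nat \<times> nat \<Rightarrow> 'a::field) set"
  assumes "mat.subspace \<A>" "\<A> \<subseteq> matrices m1 m2"
  obtains M where "M \<subseteq> pivot ` (\<A> - {0})" "M \<subseteq> {1..m1} \<times> {1..m2}"
    "inj_on fst M" "inj_on snd M" "rho_space m1 m2 \<A> \<le> card M"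
proof -
  define E where "E = pivot ` (\<A> - {0})"
  have E: "E \<subseteq> {1..m1} \<times> {1..m2}"
    using assms(2) pivot_nonzero unfolding E_def matrices_def by blast
  then have "finite E"
    by (rule finite_subset) simp
  from koenig[OF this] obtain M S1 S2 where M: "M \<subseteq> E" "inj_on fst M" "inj_on snd M"
    and S: "vertex_cover E S1 S2" "card S1 + card S2 \<le> card M"
    by blast
  \<comment> \<open>\<open>rho_space\<close> admits only subsets of the index ranges. All pivots lie
    in the format, so cutting the cover down loses no edge and does not enlarge it.\<close>
  define R1 R2 where "R1 = S1 \<inter> {1..m1}" and "R2 = S2 \<inter> {1..m2}"
  have "E \<subseteq> (R1 \<times> {1..m2}) \<union> ({1..m1} \<times> R2)"
    using S(1) E unfolding vertex_cover_def R1_def R2_def by fast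
  then have "\<exists>S1 \<subseteq> {1..m1}. \<exists>S2 \<subseteq> {1..m2}. pivots \<A> \<subseteq> (S1 \<times> {1..m2}) \<union> ({1..m1} \<times> S2) \<and>
      card R1 + card R2 = card S1 + card S2"
    unfolding pivots_eq[OF assms] E_def[symmetric]
    by (intro exI[of _ R1] exI[of _ R2] conjI) (auto simp: R1_def R2_def)
  then have "rho_space m1 m2 \<A> \<le> card R1 + card R2"
    unfolding rho_space_def by (rule Least_le)
  also have "\<dots> \<le> card S1 + card S2"
    using S(1) unfolding vertex_cover_def R1_def R2_def by (intro add_mono card_mono) auto
  finally show ?thesis
    using that[of M] M S(2) E unfolding E_def by force
qed

subsection \<open>Boundedness of unit degenerations\<close>

text \<open>Fraction-free elimination: Laurent polynomials form a domain but not a field, so pivot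
  rows are cross-multiplied instead of divided.\<close>

lemma exists_left_kernel_vector:
  fixes f :: "'i \<Rightarrow> nat \<Rightarrow> 'r::idom"
  assumes "finite I" "m < card I"
  shows "\<exists>v. (\<exists>i\<in>I. v i \<noteq> 0) \<and> (\<forall>j<m. (\<Sum>i\<in>I. v i * f i j) = 0)"
  using assms
proof (induction m arbitrary: f I)
  case 0
  then show ?case
    by (intro exI[of _ "\<lambda>_. 1"]) (auto simp: card_gt_0_iff)
next
  case (Suc m)
  show ?case
  proof (cases "\<forall>i\<in>I. f i m = 0")
    case True
    obtain v where "\<exists>i\<in>I. v i \<noteq> 0" "\<forall>j<m. (\<Sum>i\<in>I. v i * f i j) = 0"
      using Suc.IH[of I f] Suc.prems by auto
    with True show ?thesis
      by (intro exI[of _ v]) (auto simp: less_Suc_eq)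
  next
    case False
    then obtain k where k: "k \<in> I" "f k m \<noteq> 0"
      by blast
    define g where "g i j = f k m * f i j - f i m * f k j" for i j
    have "m < card (I - {k})"
      using Suc.prems k by simp
    then obtain w where w: "\<exists>i\<in>I - {k}. w i \<noteq> 0" "\<And>j. j < m \<Longrightarrow> (\<Sum>i\<in>I - {k}. w i * g i j) = 0"
      using Suc.IH[of "I - {k}" g] Suc.prems by auto
    \<comment> \<open>The coefficient at \<open>k\<close> is chosen so that \<open>v\<close>
      combines the rows of \<open>f\<close> exactly as \<open>w\<close> combines those of
      \<open>g\<close>, whose column \<open>m\<close> is zero.\<close>
    define v where "v i = (if i = k then - (\<Sum>i\<in>I - {k}. w i * f i m) else f k m * w i)" for i
    have "(\<Sum>i\<in>I. v i * f i j) = (\<Sum>i\<in>I - {k}. w i * g i j)" for j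
    proof -
      have "(\<Sum>i\<in>I. v i * f i j) = v k * f k j + (\<Sum>i\<in>I - {k}. f k m * w i * f i j)"
        using Suc.prems k by (subst sum.remove[of _ k]) (auto simp: v_def)
      then show ?thesis
        by (simp add: v_def g_def sum_distrib_left sum_distrib_right sum_subtractf algebra_simps)
    qed
    moreover have "(\<Sum>i\<in>I - {k}. w i * g i m) = 0"
      by (simp add: g_def mult.commute)
    moreover have "\<exists>i\<in>I. v i \<noteq> 0"
      using w(1) k(2) by (auto simp: v_def)
    ultimately show ?thesis
      using w(2) by (intro exI[of _ v]) (auto simp: less_Suc_eq)
  qed
qed

lemma lookup_mult_single:
  fixes v :: "'a::comm_semiring_0 laurent_poly"
  shows "Poly_Mapping.lookup (v * Poly_Mapping.single s c) k = Poly_Mapping.lookup v (k - s) * c"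
proof -
  have eq: "k = q + s' \<longleftrightarrow> s' = k - q" for q s'
    by auto
  have "(\<Sum>s'. Poly_Mapping.lookup (Poly_Mapping.single s c) s' when k = q + s') = (c when q = k - s)" for q
    unfolding eq by (simp add: lookup_single when_def)
  then show ?thesis
    by (simp add: lookup_mult mult_when)
qed

text \<open>Supplies the bound that makes the \<open>GREATEST\<close> in
  \<open>border_subrank\<close> meaningful. With more than \<open>n 1\<close> rows, \<open>A\<close>
  has a left kernel vector, which then annihilates the transformed tensor in its first
  position.\<close>

lemma degenerates_to_unit_le:
  fixes T :: "nat \<Rightarrow> nat \<Rightarrow> nat \<Rightarrow> 'a::field"
  assumes "degenerates_to_unit n T r"
  shows "r \<le> n 1"
proof (rule ccontr)
  assume "\<not> r \<le> n 1"
  obtain A B C :: "nat \<times> nat \<Rightarrow> 'a laurent_poly" and t :: nat and S :: "nat \<Rightarrow> nat \<Rightarrow> nat \<Rightarrow> nat \<Rightarrow> 'a"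
    where eq: "apply_matrices n A B C T =
      (\<lambda>b1 b2 b3. Poly_Mapping.single 0 (unit_tensor r b1 b2 b3) +
          (\<Sum>s = 1..t. Poly_Mapping.single (int s) (S s b1 b2 b3)))"
    using assms unfolding degenerates_to_unit_def by blast
  \<comment> \<open>\<open>Suc a\<close> appears because the kernel lemma counts columns from 0 and
    tensors count from 1.\<close>
  obtain v where nz: "\<exists>b\<in>{1..r}. v b \<noteq> 0" and ker: "\<forall>a<n 1. (\<Sum>b\<in>{1..r}. v b * A (b, Suc a)) = 0"
    using exists_left_kernel_vector[of "{1..r}" "n 1" "\<lambda>b a. A (b, Suc a)"] \<open>\<not> r \<le> n 1\<close> by auto
  have zero: "(\<Sum>b = 1..r. v b * apply_matrices n A B C T b b2 b3) = 0" for b2 b3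
  proof -
    have "(\<Sum>b = 1..r. v b * A (b, a)) = 0" if "a \<in> {1..n 1}" for a
      using ker[rule_format, of "a - 1"] that by auto
    then have "(\<Sum>a1 = 1..n 1. (\<Sum>b = 1..r. v b * A (b, a1)) * (\<Sum>a2 = 1..n 2. \<Sum>a3 = 1..n 3.
        B (b2, a2) * C (b3, a3) * Poly_Mapping.single 0 (T a1 a2 a3))) = 0"
      by simp
    moreover have "(\<Sum>b = 1..r. v b * apply_matrices n A B C T b b2 b3) =
      (\<Sum>a1 = 1..n 1. (\<Sum>b = 1..r. v b * A (b, a1)) * (\<Sum>a2 = 1..n 2. \<Sum>a3 = 1..n 3.
        B (b2, a2) * C (b3, a3) * Poly_Mapping.single 0 (T a1 a2 a3)))"
      unfolding apply_matrices_def sum_distrib_left sum_distrib_right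
      by (simp only: sum.swap[where A = "{1..r}"] mult.assoc)
    ultimately show ?thesis
      by simp
  qed
  \<comment> \<open>Compare lowest-order coefficients in the kernel relation: modulo \<open>\<epsilon>\<close> the tensor is the unit tensor.\<close>
  define K where "K = Min (\<Union>b\<in>{1..r}. Poly_Mapping.keys (v b))"
  have keys: "(\<Union>b\<in>{1..r}. Poly_Mapping.keys (v b)) \<noteq> {}" "finite (\<Union>b\<in>{1..r}. Poly_Mapping.keys (v b))"
    using nz by auto
  then obtain b where b: "b \<in> {1..r}" "Poly_Mapping.lookup (v b) K \<noteq> 0"
    using Min_in[of "\<Union>b\<in>{1..r}. Poly_Mapping.keys (v b)"] unfolding K_def
    by (auto simp: in_keys_iff)
  have low: "Poly_Mapping.lookup (v c) k = 0" if "c \<in> {1..r}" "k < K" for c k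
  proof (rule ccontr)
    assume "Poly_Mapping.lookup (v c) k \<noteq> 0"
    then have "k \<in> (\<Union>b\<in>{1..r}. Poly_Mapping.keys (v b))"
      using that(1) by (auto simp: in_keys_iff)
    then show False
      using Min_le[OF keys(2)] that(2) unfolding K_def by fastforce
  qed
  \<comment> \<open>A term of order \<open>s > 0\<close> meets the coefficient of \<open>v c\<close>
    at \<open>K - s\<close>, which is zero by \<open>low\<close>; the unit tensor at
    \<open>(c, b, b)\<close> leaves only \<open>c = b\<close>.\<close>
  have "Poly_Mapping.lookup (v c * apply_matrices n A B C T c b b) K =
      (if c = b then Poly_Mapping.lookup (v b) K else 0)" if "c \<in> {1..r}" for c
    using that b(1) low[OF that] unfolding eq
    by (simp add: distrib_left sum_distrib_left lookup_add lookup_sum lookup_mult_single unit_tensor_def)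
  then have "Poly_Mapping.lookup (\<Sum>c = 1..r. v c * apply_matrices n A B C T c b b) K
      = Poly_Mapping.lookup (v b) K"
    using b(1) by (simp add: lookup_sum)
  then show False
    using b(2) zero by simp
qed

lemma degenerates_to_unit_le_border_subrank:
  "degenerates_to_unit n T r \<Longrightarrow> r \<le> border_subrank n T"
  unfolding border_subrank_def by (rule Greatest_le_nat) (auto intro: degenerates_to_unit_le)

subsection \<open>Degeneration to a matching of pivots\<close>

lemma triple_sum_permute:
  fixes f :: "nat \<Rightarrow> nat \<Rightarrow> nat \<Rightarrow> 'b::comm_monoid_add" and n :: "nat \<Rightarrow> nat"
  assumes "i \<in> {1, 2, 3}" "j \<in> {1, 2, 3}" "i \<noteq> j" "{1, 2, 3} - {i, j} = {l}"
  shows "(\<Sum>a1 = 1..n 1. \<Sum>a2 = 1..n 2. \<Sum>a3 = 1..n 3. f a1 a2 a3) =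
    (\<Sum>a = 1..n i. \<Sum>b = 1..n j. \<Sum>t = 1..n l.
      let x = (\<lambda>_. t)(i := a, j := b) in f (x 1) (x 2) (x 3))"
proof -
  have swap: "(\<Sum>x\<in>X. \<Sum>y\<in>Y. \<Sum>z\<in>Z. g x y z) = (\<Sum>x\<in>X. \<Sum>z\<in>Z. \<Sum>y\<in>Y. g x y z)"
    for g :: "nat \<Rightarrow> nat \<Rightarrow> nat \<Rightarrow> 'b" and X Y Z
    by (rule sum.cong[OF refl sum.swap])
  have "(i, j, l) \<in> {(1, 2, 3), (1, 3, 2), (2, 1, 3), (2, 3, 1), (3, 1, 2), (3, 2, 1)}"
    using assms by auto
  then show ?thesis
    \<comment> \<open>The identity arrangement is closed here; the next five lines treat the other
      permutations in the listed order.\<close>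
    apply (elim insertE emptyE; simp add: Let_def)
        apply (rule swap)
       apply (rule sum.swap)
      apply (subst sum.swap, rule swap)
     apply (subst swap, rule sum.swap)
    apply (subst sum.swap, subst swap, rule sum.swap)
    done
qed

text \<open>Packing the matrices into a family \<open>G\<close> and the output indices into
  \<open>\<beta>\<close> confines the case split over \<open>(i, j, l)\<close> to this lemma and the
  reordering of sums.\<close>

lemma apply_matrices_slice:
  fixes G :: "nat \<Rightarrow> nat \<times> nat \<Rightarrow> 'a::field laurent_poly" and \<beta> :: "nat \<Rightarrow> nat"
  assumes "i \<in> {1, 2, 3}" "j \<in> {1, 2, 3}" "i \<noteq> j" "{1, 2, 3} - {i, j} = {l}"
  shows "apply_matrices n (G 1) (G 2) (G 3) T (\<beta> 1) (\<beta> 2) (\<beta> 3) =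
    (\<Sum>a = 1..n i. \<Sum>b = 1..n j. \<Sum>t = 1..n l. G i (\<beta> i, a) * G j (\<beta> j, b) * G l (\<beta> l, t) *
      Poly_Mapping.single 0 (slice i j T t (a, b)))"
proof -
  have "(i, j, l) \<in> {(1, 2, 3), (1, 3, 2), (2, 1, 3), (2, 3, 1), (3, 1, 2), (3, 2, 1)}"
    using assms by auto
  then have term_eq: "(let x = (\<lambda>_. t)(i := a, j := b) in
      G 1 (\<beta> 1, x 1) * G 2 (\<beta> 2, x 2) * G 3 (\<beta> 3, x 3) * Poly_Mapping.single 0 (T (x 1) (x 2) (x 3))) =
    G i (\<beta> i, a) * G j (\<beta> j, b) * G l (\<beta> l, t) * Poly_Mapping.single 0 (slice i j T t (a, b))"
    for a b t
    by (elim insertE emptyE) (simp_all add: slice_def Let_def mult_ac)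
  then show ?thesis
    unfolding apply_matrices_def
    by (subst triple_sum_permute[OF assms, where n = n]) (intro sum.cong refl term_eq)
qed

text \<open>Coefficients belong to indices, not to vectors, since different slices may
  coincide.\<close>

lemma span_image_coefficients:
  fixes f :: "'i \<Rightarrow> nat \<times> nat \<Rightarrow> 'a::field"
  assumes "D \<in> mat.span (f ` I)" "finite I"
  shows "\<exists>c. \<forall>p. D p = (\<Sum>t\<in>I. c t * f t p)"
  using assms(1)
proof (induction rule: mat.span_induct_alt)
  case base
  show ?case
    by (intro exI[of _ "\<lambda>_. 0"]) simp
next
  case (step k x y)
  then obtain c s where c: "\<forall>p. y p = (\<Sum>t\<in>I. c t * f t p)" and s: "s \<in> I" "x = f s"
    by auto
  have "(\<Sum>t\<in>I. (c t + (if t = s then k else 0)) * f t p) = (\<Sum>t\<in>I. c t * f t p) + k * f s p" for p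
    using s(1) assms(2) by (simp add: distrib_right sum.distrib if_distrib[of "\<lambda>x. x * _"] cong: if_cong)
  then show ?case
    using c s(2) by (intro exI[of _ "\<lambda>t. c t + (if t = s then k else 0)"]) (simp add: mat_scale_def)
qed

text \<open>The error tensors are read off as the coefficients of \<open>X\<close> at the positive
  exponents.\<close>

lemma degenerates_to_unitI:
  fixes T :: "nat \<Rightarrow> nat \<Rightarrow> nat \<Rightarrow> 'a::field"
  assumes mats: "A \<in> matrices r (n 1)" "B \<in> matrices r (n 2)" "C \<in> matrices r (n 3)"
    and X: "X = apply_matrices n A B C T" "X \<in> tensors (\<lambda>_. r)"
    and keys: "\<And>b1 b2 b3. Poly_Mapping.keys (X b1 b2 b3) \<subseteq> {0..int t}"
    and unit: "\<And>b1 b2 b3. Poly_Mapping.lookup (X b1 b2 b3) 0 = unit_tensor r b1 b2 b3"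
  shows "degenerates_to_unit n T r"
proof -
  define S where "S s b1 b2 b3 = Poly_Mapping.lookup (X b1 b2 b3) (int s)" for s b1 b2 b3
  have S: "S s \<in> tensors (\<lambda>_. r)" for s
    using X(2) unfolding tensors_def S_def by (auto simp: in_keys_iff) (metis lookup_zero)+
  have "X b1 b2 b3 = Poly_Mapping.single 0 (unit_tensor r b1 b2 b3) +
      (\<Sum>s = 1..t. Poly_Mapping.single (int s) (S s b1 b2 b3))" for b1 b2 b3
  proof (rule poly_mapping_eqI)
    fix k
    have "(\<Sum>s = 1..t. S s b1 b2 b3 when int s = k) =
        (if k \<in> {1..int t} then Poly_Mapping.lookup (X b1 b2 b3) k else 0)"
    proof (cases "k \<in> {1..int t}")
      case True
      then obtain m where "k = int m"
        using zero_le_imp_eq_int[of k] by auto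
      then show ?thesis
        using True by (simp add: when_def S_def)
    next
      case False
      then show ?thesis
        by (intro trans[OF sum.neutral]) (auto simp: when_def)
    qed
    moreover have "Poly_Mapping.lookup (X b1 b2 b3) k = 0" if "k \<notin> {0..int t}"
      using keys[of b1 b2 b3] that by (meson in_keys_iff subsetD)
    ultimately show "Poly_Mapping.lookup (X b1 b2 b3) k =
        Poly_Mapping.lookup (Poly_Mapping.single 0 (unit_tensor r b1 b2 b3) +
          (\<Sum>s = 1..t. Poly_Mapping.single (int s) (S s b1 b2 b3))) k"
      by (cases "k = 0") (auto simp: lookup_add lookup_sum lookup_single unit)
  qed
  then have "apply_matrices n A B C T = (\<lambda>b1 b2 b3. Poly_Mapping.single 0 (unit_tensor r b1 b2 b3) +
      (\<Sum>s = 1..t. Poly_Mapping.single (int s) (S s b1 b2 b3)))"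
    unfolding X(1)[symmetric] by (intro ext)
  with mats S show ?thesis
    unfolding degenerates_to_unit_def by blast
qed

text \<open>The functional \<open>w\<close> with \<open>N = m + 1\<close>: one step down in the rows
  outweighs any column index up to \<open>m\<close>.\<close>

definition lex_weight :: "nat \<Rightarrow> nat \<times> nat \<Rightarrow> int" where
  "lex_weight m p = int (Suc m * fst p + snd p)"

lemma lex_weight_strict_mono:
  assumes "p < q" "snd p \<le> m"
  shows "lex_weight m p < lex_weight m q"
proof (cases "fst p < fst q")
  case True
  then have "Suc m * Suc (fst p) \<le> Suc m * fst q"
    by (intro mult_le_mono2) simp
  then have "Suc m + Suc m * fst p \<le> Suc m * fst q"
    by simp
  then show ?thesis
    unfolding lex_weight_def of_nat_less_iff using assms(2) by linarith
next
  case False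
  then show ?thesis
    using assms(1) by (auto simp: lex_weight_def less_prod_def')
qed

lemma degenerates_to_matching:
  fixes T :: "nat \<Rightarrow> nat \<Rightarrow> nat \<Rightarrow> 'a::field"
  assumes ij: "i \<in> {1, 2, 3}" "j \<in> {1, 2, 3}" "i \<noteq> j"
    and M: "M \<subseteq> pivot ` (slice_space n i j T - {0})" "M \<subseteq> {1..n i} \<times> {1..n j}"
      "inj_on fst M" "inj_on snd M"
  shows "degenerates_to_unit n T (card M)"
proof -
  define r where "r = card M"
  obtain l where l: "{1, 2, 3} - {i, j} = {l}"
    using ij by (auto simp: insert_Diff_if)
  have "finite M"
    using M(2) by (rule finite_subset) simp
  then obtain h where h: "bij_betw h {1..r} M"
    unfolding r_def using ex_bij_betw_nat_finite_1 by blast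
  then have hM: "h k \<in> M" if "k \<in> {1..r}" for k
    using that by (auto simp: bij_betw_def)
  have inj: "inj_on (\<lambda>k. fst (h k)) {1..r}" "inj_on (\<lambda>k. snd (h k)) {1..r}"
    using comp_inj_on[of h "{1..r}" fst] comp_inj_on[of h "{1..r}" snd] h M(3,4)
    by (auto simp: bij_betw_def comp_def)
  \<comment> \<open>Dividing by the pivot entry normalises it to 1, so that the diagonal of the
    limit is exactly that of the unit tensor.\<close>
  have "\<exists>c. (\<Sum>t = 1..n l. c t * slice i j T t (h k)) = 1 \<and>
      (\<forall>q. (\<Sum>t = 1..n l. c t * slice i j T t q) \<noteq> 0 \<longrightarrow> h k \<le> q)" if k: "k \<in> {1..r}" for k
  proof -
    obtain D where D: "D \<in> slice_space n i j T" "D \<noteq> 0" "h k = pivot D"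
      using M(1) hM[OF k] by auto
    then have "D \<in> mat.span (slice i j T ` {1..n l})"
      unfolding slice_space_def Let_def l the_elem_eq by blast
    from span_image_coefficients[OF this] obtain c where
      c: "\<And>p. D p = (\<Sum>t = 1..n l. c t * slice i j T t p)"
      by auto
    have "(\<Sum>t = 1..n l. c t / D (h k) * slice i j T t p) = D p / D (h k)" for p
      unfolding c[of p] by (simp add: sum_divide_distrib)
    then show ?thesis
      using D pivot_nonzero[of D] pivot_le[of D]
      by (intro exI[of _ "\<lambda>t. c t / D (h k)"]) simp
  qed
  then obtain c where c: "\<And>k. k \<in> {1..r} \<Longrightarrow> (\<Sum>t = 1..n l. c k t * slice i j T t (h k)) = 1"
    and c_le: "\<And>k q. k \<in> {1..r} \<Longrightarrow> (\<Sum>t = 1..n l. c k t * slice i j T t q) \<noteq> 0 \<Longrightarrow> h k \<le> q"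
    by metis
  define w where "w = lex_weight (n j)"
  \<comment> \<open>Linearity of the weight lets \<open>w (a, b)\<close> be split between the row
    factor in \<open>R\<close> and the column factor in \<open>L\<close>; \<open>U\<close> subtracts
    the weight of the pivot.\<close>
  define R where "R = (\<lambda>(k, a). if k \<in> {1..r} \<and> a = fst (h k)
    then Poly_Mapping.single (w (a, 0)) (1::'a) else 0)"
  define L where "L = (\<lambda>(k, b). if k \<in> {1..r} \<and> b = snd (h k)
    then Poly_Mapping.single (w (0, b)) (1::'a) else 0)"
  define U where "U = (\<lambda>(k, t). if k \<in> {1..r} \<and> t \<in> {1..n l}
    then Poly_Mapping.single (- w (h k)) (c k t) else 0)"
  define G where "G q = (if q = i then R else if q = j then L else U)" for q
  have perm: "{1, 2, 3} = {i, j, l}" and "i \<noteq> l" "j \<noteq> l"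
    using ij l by blast+
  have G: "G i = R" "G j = L" "G l = U"
    using ij(3) \<open>i \<noteq> l\<close> \<open>j \<noteq> l\<close> by (simp_all add: G_def)
  have range: "fst (h k) \<in> {1..n i}" "snd (h k) \<in> {1..n j}" if "k \<in> {1..r}" for k
    using hM[OF that] M(2) by auto
  have mats: "G q \<in> matrices r (n q)" if "q \<in> {1, 2, 3}" for q
  proof -
    have "q \<in> {i, j, l}"
      using that unfolding perm .
    moreover have "R \<in> matrices r (n i)" "L \<in> matrices r (n j)" "U \<in> matrices r (n l)"
      unfolding matrices_def R_def L_def U_def using range by (force split: if_splits)+
    ultimately show ?thesis
      using G by fastforce
  qed
  define X where "X = apply_matrices n (G 1) (G 2) (G 3) T"
  define d where "d k p = (\<Sum>t = 1..n l. c k t * slice i j T t p)" for k p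
  define e where "e \<beta> = (fst (h (\<beta> i)), snd (h (\<beta> j)))" for \<beta> :: "nat \<Rightarrow> nat"
  \<comment> \<open>Only one row and one column survive, and all slices enter with the same
    exponent, so each entry is a single monomial or zero.\<close>
  have X: "X (\<beta> 1) (\<beta> 2) (\<beta> 3) = (if \<beta> i \<in> {1..r} \<and> \<beta> j \<in> {1..r} \<and> \<beta> l \<in> {1..r}
      then Poly_Mapping.single (w (e \<beta>) - w (h (\<beta> l))) (d (\<beta> l) (e \<beta>)) else 0)" for \<beta>
  proof (cases "\<beta> i \<in> {1..r} \<and> \<beta> j \<in> {1..r} \<and> \<beta> l \<in> {1..r}")
    case False
    then show ?thesis
      unfolding X_def apply_matrices_slice[OF ij l] G by (auto simp: R_def L_def U_def)
  next
    case True
    have "w (a, 0) + (w (0, b) - z) = w (a, b) - z" for a b z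
      by (simp add: w_def lex_weight_def)
    then have "X (\<beta> 1) (\<beta> 2) (\<beta> 3) = (\<Sum>a = 1..n i. \<Sum>b = 1..n j. if b = snd (h (\<beta> j)) then
        if a = fst (h (\<beta> i)) then
          \<Sum>t = 1..n l. Poly_Mapping.single (w (a, b) - w (h (\<beta> l))) (c (\<beta> l) t * slice i j T t (a, b))
        else 0 else 0)"
      unfolding X_def apply_matrices_slice[OF ij l] G
      using True by (intro sum.cong refl) (auto simp: R_def L_def U_def mult_single intro!: sum.cong)
    also have "\<dots> = (\<Sum>t = 1..n l. Poly_Mapping.single (w (e \<beta>) - w (h (\<beta> l)))
        (c (\<beta> l) t * slice i j T t (e \<beta>)))"
      using range[of "\<beta> i"] range[of "\<beta> j"] True by (simp add: e_def)
    also have "\<dots> = Poly_Mapping.single (w (e \<beta>) - w (h (\<beta> l))) (d (\<beta> l) (e \<beta>))"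
      unfolding d_def by (rule poly_mapping_eqI) (simp add: lookup_sum lookup_single when_def)
    finally show ?thesis
      using True by simp
  qed
  have ex: "\<exists>\<beta> :: nat \<Rightarrow> nat. \<beta> 1 = b1 \<and> \<beta> 2 = b2 \<and> \<beta> 3 = b3" for b1 b2 b3
    by (intro exI[of _ "(\<lambda>_. b3)(1 := b1, 2 := b2)"]) simp
  \<comment> \<open>Carries conditions symmetric in the three positions between the orders
    \<open>1, 2, 3\<close> and \<open>i, j, l\<close>.\<close>
  have all: "(P 1 \<and> P 2 \<and> P 3) \<longleftrightarrow> (P i \<and> P j \<and> P l)" for P :: "nat \<Rightarrow> bool"
  proof -
    have "(\<forall>q \<in> {1, 2, 3}. P q) \<longleftrightarrow> (\<forall>q \<in> {i, j, l}. P q)"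
      unfolding perm ..
    then show ?thesis by simp
  qed
  \<comment> \<open>A nonzero entry does not precede its pivot, so the exponent is nonnegative. It
    is zero only at the pivot itself, where the matching property forces the three indices to
    agree.\<close>
  have le: "w (h (\<beta> l)) \<le> w (e \<beta>) \<and> (w (h (\<beta> l)) = w (e \<beta>) \<longrightarrow> \<beta> i = \<beta> l \<and> \<beta> j = \<beta> l)"
    if \<beta>: "\<beta> i \<in> {1..r} \<and> \<beta> j \<in> {1..r} \<and> \<beta> l \<in> {1..r}" and nz: "d (\<beta> l) (e \<beta>) \<noteq> 0" for \<beta> :: "nat \<Rightarrow> nat"
  proof (cases "h (\<beta> l) = e \<beta>")
    case True
    then have "fst (h (\<beta> l)) = fst (h (\<beta> i))" "snd (h (\<beta> l)) = snd (h (\<beta> j))"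
      by (simp_all add: e_def)
    then have "\<beta> l = \<beta> i" "\<beta> l = \<beta> j"
      using inj \<beta> by (auto dest: inj_onD)
    then show ?thesis
      using True by simp
  next
    case False
    then have "h (\<beta> l) < e \<beta>"
      using c_le[of "\<beta> l" "e \<beta>"] nz \<beta> by (simp add: d_def order_less_le)
    then have "w (h (\<beta> l)) < w (e \<beta>)"
      unfolding w_def using range(2)[of "\<beta> l"] \<beta> by (intro lex_weight_strict_mono) auto
    then show ?thesis
      by simp
  qed
  \<comment> \<open>This is the weight of the last position \<open>(n i, n j)\<close>, hence an
    upper bound for all exponents.\<close>
  let ?t = "Suc (n j) * n i + n j"
  have "degenerates_to_unit n T r"
  proof (rule degenerates_to_unitI[OF _ _ _ X_def, where t = ?t])
    show "G 1 \<in> matrices r (n 1)" "G 2 \<in> matrices r (n 2)" "G 3 \<in> matrices r (n 3)"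
      by (simp_all add: mats)
    have "\<beta> 1 \<in> {1..r} \<and> \<beta> 2 \<in> {1..r} \<and> \<beta> 3 \<in> {1..r}" if "X (\<beta> 1) (\<beta> 2) (\<beta> 3) \<noteq> 0" for \<beta> :: "nat \<Rightarrow> nat"
      unfolding all[of "\<lambda>q. \<beta> q \<in> {1..r}"] using that X[of \<beta>] by presburger
    then have "b1 \<in> {1..r} \<and> b2 \<in> {1..r} \<and> b3 \<in> {1..r}" if "X b1 b2 b3 \<noteq> 0" for b1 b2 b3
      using ex[of b1 b2 b3] that by blast
    then show "X \<in> tensors (\<lambda>_. r)"
      unfolding tensors_def by blast
  next
    fix b1 b2 b3
    obtain \<beta> :: "nat \<Rightarrow> nat" where \<beta>: "b1 = \<beta> 1" "b2 = \<beta> 2" "b3 = \<beta> 3"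
      using ex by metis
    have "w (e \<beta>) \<le> int ?t" if "\<beta> i \<in> {1..r}" "\<beta> j \<in> {1..r}"
    proof -
      have "Suc (n j) * fst (h (\<beta> i)) + snd (h (\<beta> j)) \<le> ?t"
        using range[of "\<beta> i"] range[of "\<beta> j"] that by (intro add_mono mult_le_mono2) auto
      then show ?thesis
        unfolding w_def lex_weight_def e_def fst_conv snd_conv by (rule of_nat_mono)
    qed
    moreover have "0 \<le> w p" for p
      by (simp add: w_def lex_weight_def)
    ultimately have "w (e \<beta>) - w (h (\<beta> l)) \<in> {0..int ?t}"
      if "\<beta> i \<in> {1..r} \<and> \<beta> j \<in> {1..r} \<and> \<beta> l \<in> {1..r}" "d (\<beta> l) (e \<beta>) \<noteq> 0"
      using le[OF that] that(1) by (smt (verit) atLeastAtMost_iff)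
    then show "Poly_Mapping.keys (X b1 b2 b3) \<subseteq> {0..int ?t}"
      unfolding \<beta> X[of \<beta>] by (simp only: keys_single keys_zero split: if_split) blast
    have unit: "unit_tensor r b1 b2 b3 = (if \<beta> i \<in> {1..r} \<and> \<beta> i = \<beta> l \<and> \<beta> j = \<beta> l then 1 else (0::'a))"
    proof -
      have "b1 \<in> {1..r} \<and> b1 = b2 \<and> b2 = b3 \<longleftrightarrow> \<beta> i \<in> {1..r} \<and> \<beta> i = \<beta> l \<and> \<beta> j = \<beta> l"
        using all[of "\<lambda>q. \<beta> q = \<beta> 1"] all[of "\<lambda>q. \<beta> q = \<beta> l"] all[of "\<lambda>q. \<beta> q \<in> {1..r}"]
        unfolding \<beta> by metis
      then show ?thesis
        unfolding unit_tensor_def by (simp only:)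
    qed
    show "Poly_Mapping.lookup (X b1 b2 b3) 0 = unit_tensor r b1 b2 b3"
    proof (cases "\<beta> i \<in> {1..r} \<and> \<beta> i = \<beta> l \<and> \<beta> j = \<beta> l")
      case True
      then have "e \<beta> = h (\<beta> l)" "d (\<beta> l) (h (\<beta> l)) = 1"
        using c[of "\<beta> l"] by (simp_all add: e_def d_def)
      then show ?thesis
        unfolding unit unfolding \<beta> X[of \<beta>] using True by simp
    next
      case False
      then show ?thesis
        unfolding unit unfolding \<beta> X[of \<beta>] using le[of \<beta>] by (simp only: lookup_single lookup_zero when_def split: if_split) force
    qed
  qed
  then show ?thesis
    by (simp add: r_def)
qed

lemma slice_space_subset_matrices:
  assumes "T \<in> tensors n" "i \<in> {1, 2, 3}" "j \<in> {1, 2, 3}" "i \<noteq> j"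
  shows "slice_space n i j T \<subseteq> matrices (n i) (n j)"
proof -
  have "slice i j T t \<in> matrices (n i) (n j)" for t
    using assms unfolding tensors_def matrices_def slice_def
    by (auto simp: Let_def split: if_splits)
  moreover have "mat.subspace (matrices (n i) (n j) :: (nat \<times> nat \<Rightarrow> 'a::field) set)"
    unfolding mat.subspace_def matrices_def mat_scale_def by auto (metis add.left_neutral)+
  ultimately show ?thesis
    unfolding slice_space_def Let_def by (intro mat.span_minimal) auto
qed

theorem theorem5p13:
  fixes n :: "nat \<Rightarrow> nat" and T :: "nat \<Rightarrow> nat \<Rightarrow> nat \<Rightarrow> 'a::field" and i j :: nat
  assumes "T \<in> tensors n"
    and "i \<in> {1, 2, 3}" and "j \<in> {1, 2, 3}" and "i \<noteq> j"
  shows "rho n i j T \<le> border_subrank n T"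
proof -
  have "mat.subspace (slice_space n i j T)"
    unfolding slice_space_def Let_def by (rule mat.subspace_span)
  from rho_space_le_matching[OF this slice_space_subset_matrices[OF assms]]
  obtain M where "M \<subseteq> pivot ` (slice_space n i j T - {0})" "M \<subseteq> {1..n i} \<times> {1..n j}"
    "inj_on fst M" "inj_on snd M" and "rho_space (n i) (n j) (slice_space n i j T) \<le> card M"
    by blast
  then have "degenerates_to_unit n T (card M)" "rho n i j T \<le> card M"
    using degenerates_to_matching[OF assms(2-4)] by (auto simp: rho_def)
  then show ?thesis
    using degenerates_to_unit_le_border_subrank order.trans by blast
qed

end
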